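(* Let $Y\subseteq X$ be complex analytic subsets of $\mathbb C^n$ with $0\in Y$, $Y$ smooth (and taken to be linear), and $S(X)\subseteq Y$. With $\mathcal E_2$ as defined in the context, $X$ satisfies Whitney's condition $(a)$ over $Y$ at $0$ if and only if $\mathcal E_2=\emptyset$.
   Context: $S(X)$ is the singular set of $X$. Whitney's condition $(a)$ over $Y$ at $0$: every limit, as regular points $x\in X$ tend to $0$, of hyperplanes containing $T_xX$ contains $T_0Y=Y$. The conormal modification of an analytic set $X$ is the closure in $X\times\check{\mathbb P}^{n-1}$ of the set of pairs $(x,H)$ with $x$ a regular point of $X$ and $H$ a hyperplane containing $T_xX$; its fibre over $0$ is denoted $\mathcal C(X)$ (so $\mathcal C(Y)$ is the set of hyperplanes containing $Y$). Blow up the conormal modification of $X$ along the pull-back of the maximal ideal of $X$ at $0$, and let $E$ be the exceptional divisor, whose points are pairs $(\ell,H)$ with $\ell$ a line in the tangent cone of $X$ at $0$ and $H\in\mathcal C(X)$. Let $\pi_2(\ell,H)=H$ and let $\mathcal E$ be the set of irreducible components of $E$. Let $\mathcal E_1$ be the set of those $C\in\mathcal E$ with $\pi_2(C)\subseteq\mathcal C(Y)$, and $\mathcal E_2=\mathcal E\setminus\mathcal E_1$. *)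

theory Defs
  imports "HOL-Analysis.Analysis"
begin

section \<open>Analytic sets in \<open>\<complex>\<^sup>n\<close>\<close>

text \<open>The Frechet derivative on \<open>complex ^ 'm\<close> is only real-linear a priori; holomorphy on an
  open set means that it is complex-linear at every point.\<close>

definition holomorphic_fun_on :: "(complex ^ 'm \<Rightarrow> complex) \<Rightarrow> (complex ^ 'm) set \<Rightarrow> bool" where
  "holomorphic_fun_on f U \<longleftrightarrow>
     (\<forall>z\<in>U. \<exists>D. (f has_derivative D) (at z) \<and> (\<forall>c v. D (c *s v) = c * D v))"

definition analytic_subset_of :: "(complex ^ 'm) set \<Rightarrow> (complex ^ 'm) set \<Rightarrow> bool" where
  "analytic_subset_of U A \<longleftrightarrow> open U \<and> A \<subseteq> U \<and>
     (\<forall>p\<in>U. \<exists>V F. open V \<and> p \<in> V \<and> V \<subseteq> U \<and> finite F \<and> (\<forall>f\<in>F. holomorphic_fun_on f V) \<and>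
        A \<inter> V = {z\<in>V. \<forall>f\<in>F. f z = 0})"

definition biholomorphic_maps ::
    "(complex ^ 'm) set \<Rightarrow> (complex ^ 'm) set \<Rightarrow> (complex ^ 'm \<Rightarrow> complex ^ 'm) \<Rightarrow>
     (complex ^ 'm \<Rightarrow> complex ^ 'm) \<Rightarrow> bool" where
  "biholomorphic_maps U V \<phi> \<psi> \<longleftrightarrow> open U \<and> open V \<and> homeomorphism U V \<phi> \<psi> \<and>
     (\<forall>i. holomorphic_fun_on (\<lambda>z. \<phi> z $ i) U) \<and> (\<forall>i. holomorphic_fun_on (\<lambda>z. \<psi> z $ i) V)"

text \<open>A point is regular if the set is a complex submanifold (of any dimension) near it.
  Note that \<open>vec.subspace\<close> means a \<^emph>\<open>complex\<close> linear subspace.\<close>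

definition regular_points :: "(complex ^ 'm) set \<Rightarrow> (complex ^ 'm) set" where
  "regular_points X = {p\<in>X. \<exists>U V \<phi> \<psi> L. p \<in> U \<and> biholomorphic_maps U V \<phi> \<psi> \<and>
     vec.subspace L \<and> \<phi> ` (X \<inter> U) = L \<inter> V}"

definition singular_set :: "(complex ^ 'm) set \<Rightarrow> (complex ^ 'm) set" where
  "singular_set X = X - regular_points X"

text \<open>The common kernel of the differentials at \<open>p\<close> of all holomorphic germs vanishing on \<open>X\<close>.
  At a regular point this is the tangent space of the submanifold; it is used only there.\<close>

definition tangent_space :: "(complex ^ 'm) set \<Rightarrow> complex ^ 'm \<Rightarrow> (complex ^ 'm) set" where
  "tangent_space X p = {v. \<forall>U f. open U \<and> p \<in> U \<and> holomorphic_fun_on f U \<and>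
     (\<forall>z\<in>X \<inter> U. f z = 0) \<longrightarrow> frechet_derivative f (at p) v = 0}"


section \<open>Projective space and its dual\<close>

text \<open>A point of projective space is a line through the origin and a point of the dual space is a
  hyperplane through the origin, both as subsets of \<open>complex ^ 'n\<close>; the topologies are the quotient
  topologies from the nonzero vectors.\<close>

definition hyperplane :: "complex ^ 'n \<Rightarrow> (complex ^ 'n) set" where
  "hyperplane a = {x. (\<Sum>i\<in>UNIV. a $ i * x $ i) = 0}"

definition line :: "complex ^ 'n \<Rightarrow> (complex ^ 'n) set" where
  "line v = vec.span {v}"

definition hyperplanes :: "(complex ^ 'n) set set" where
  "hyperplanes = hyperplane ` (- {0})"

definition quotient_topology :: "'a topology \<Rightarrow> ('a \<Rightarrow> 'b) \<Rightarrow> 'b topology" where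
  "quotient_topology T q =
     topology (\<lambda>U. U \<subseteq> q ` topspace T \<and> openin T {x \<in> topspace T. q x \<in> U})"

lemma openin_quotient_topology:
  "openin (quotient_topology T q) U \<longleftrightarrow>
     U \<subseteq> q ` topspace T \<and> openin T {x \<in> topspace T. q x \<in> U}"
proof -
  have "istopology (\<lambda>U. U \<subseteq> q ` topspace T \<and> openin T {x \<in> topspace T. q x \<in> U})"
    unfolding istopology_def
  proof (intro conjI allI impI)
    fix S U
    assume S: "S \<subseteq> q ` topspace T \<and> openin T {x \<in> topspace T. q x \<in> S}"
      and U: "U \<subseteq> q ` topspace T \<and> openin T {x \<in> topspace T. q x \<in> U}"
    show "S \<inter> U \<subseteq> q ` topspace T" using S by blast
    have "{x \<in> topspace T. q x \<in> S \<inter> U} = {x \<in> topspace T. q x \<in> S} \<inter> {x \<in> topspace T. q x \<in> U}"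
      by blast
    then show "openin T {x \<in> topspace T. q x \<in> S \<inter> U}" using S U by auto
  next
    fix K
    assume K: "\<forall>S\<in>K. S \<subseteq> q ` topspace T \<and> openin T {x \<in> topspace T. q x \<in> S}"
    show "\<Union>K \<subseteq> q ` topspace T" using K by blast
    have "{x \<in> topspace T. q x \<in> \<Union>K} = \<Union>((\<lambda>S. {x \<in> topspace T. q x \<in> S}) ` K)" by blast
    then show "openin T {x \<in> topspace T. q x \<in> \<Union>K}" using K by auto
  qed
  then show ?thesis unfolding quotient_topology_def by simp
qed

lemma topspace_quotient_topology: "topspace (quotient_topology T q) = q ` topspace T"
proof
  show "topspace (quotient_topology T q) \<subseteq> q ` topspace T"
    using openin_topspace openin_quotient_topology by metis
  have "{x \<in> topspace T. q x \<in> q ` topspace T} = topspace T" by blast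
  then have "openin (quotient_topology T q) (q ` topspace T)"
    by (simp add: openin_quotient_topology)
  then show "q ` topspace T \<subseteq> topspace (quotient_topology T q)" by (rule openin_subset)
qed

lemma quotient_map_quotient_topology: "quotient_map T (quotient_topology T q) q"
  by (simp add: quotient_map_def topspace_quotient_topology openin_quotient_topology)

definition proj_topology :: "(complex ^ 'n) set topology" where
  "proj_topology = quotient_topology (top_of_set (- {0})) line"

definition dual_proj_topology :: "(complex ^ 'n) set topology" where
  "dual_proj_topology = quotient_topology (top_of_set (- {0})) hyperplane"

text \<open>A subset of the product of projective space and its dual is analytic iff its preimage under
  the holomorphic submersion \<open>(v, a) \<mapsto> (line v, hyperplane a)\<close> from pairs of nonzero vectors is.
  A pair of vectors is encoded as one vector with index type \<open>'n + 'n\<close>.\<close>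

definition left_part :: "complex ^ ('n::finite + 'n) \<Rightarrow> complex ^ 'n" where
  "left_part w = (\<chi> i. w $ Inl i)"

definition right_part :: "complex ^ ('n::finite + 'n) \<Rightarrow> complex ^ 'n" where
  "right_part w = (\<chi> i. w $ Inr i)"

definition nonzero_pairs :: "(complex ^ ('n::finite + 'n)) set" where
  "nonzero_pairs = {w. left_part w \<noteq> 0 \<and> right_part w \<noteq> 0}"

definition biproj_analytic :: "((complex ^ 'n) set \<times> (complex ^ 'n) set) set \<Rightarrow> bool" where
  "biproj_analytic A \<longleftrightarrow> A \<subseteq> topspace (prod_topology proj_topology dual_proj_topology) \<and>
     analytic_subset_of nonzero_pairs
       {w \<in> nonzero_pairs. (line (left_part w), hyperplane (right_part w)) \<in> A}"

text \<open>Irreducible components in the sense of the Zariski topology, whose closed sets are the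
  analytic subsets: they are the maximal irreducible subsets. For analytic \<open>S\<close> such a maximal set is
  automatically closed, i.e. analytic, because the closure of an irreducible set is irreducible;
  so these are the maximal irreducible analytic subsets of \<open>S\<close>.\<close>

definition biproj_irreducible :: "((complex ^ 'n) set \<times> (complex ^ 'n) set) set \<Rightarrow> bool" where
  "biproj_irreducible C \<longleftrightarrow> C \<noteq> {} \<and>
     (\<forall>A B. biproj_analytic A \<and> biproj_analytic B \<and> C \<subseteq> A \<union> B \<longrightarrow> C \<subseteq> A \<or> C \<subseteq> B)"

definition irreducible_components ::
    "((complex ^ 'n) set \<times> (complex ^ 'n) set) set \<Rightarrow> ((complex ^ 'n) set \<times> (complex ^ 'n) set) set set" where
  "irreducible_components S =
     {C. C \<subseteq> S \<and> biproj_irreducible C \<and> (\<forall>D. D \<subseteq> S \<and> biproj_irreducible D \<and> C \<subseteq> D \<longrightarrow> D = C)}"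


section \<open>Whitney's condition (a)\<close>

definition whitney_a ::
    "(complex ^ 'n) set \<Rightarrow> (complex ^ 'n) set \<Rightarrow> complex ^ 'n \<Rightarrow> bool" where
  "whitney_a X Y p \<longleftrightarrow>
     (\<forall>x H L. (\<forall>k::nat. x k \<in> regular_points X \<and> H k \<in> hyperplanes \<and> tangent_space X (x k) \<subseteq> H k) \<and>
        x \<longlonglongrightarrow> p \<and> limitin dual_proj_topology H L sequentially
        \<longrightarrow> tangent_space Y p \<subseteq> L)"


section \<open>The conormal modification and its blow-up\<close>

definition conormal_modification ::
    "(complex ^ 'n) set \<Rightarrow> ((complex ^ 'n) \<times> (complex ^ 'n) set) set" where
  "conormal_modification X = prod_topology (top_of_set X) dual_proj_topology closure_of
     {(x, H). x \<in> regular_points X \<and> H \<in> hyperplanes \<and> tangent_space X x \<subseteq> H}"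

definition conormal_fibre :: "(complex ^ 'n) set \<Rightarrow> (complex ^ 'n) set set" where
  "conormal_fibre X = {H. (0, H) \<in> conormal_modification X}"

text \<open>The pull-back of the maximal ideal at \<open>0\<close> is generated by the coordinate functions
  \<open>x\<^sub>1, \<dots>, x\<^sub>n\<close>, so the (underlying set of the) blow-up is the closure of the graph of
  \<open>(x, H) \<mapsto> [x\<^sub>1 : \<dots> : x\<^sub>n]\<close> over the complement \<open>x \<noteq> 0\<close> of its zero locus, and the exceptional divisor
  is the part over that zero locus.\<close>

definition conormal_blowup ::
    "(complex ^ 'n) set \<Rightarrow> (((complex ^ 'n) \<times> (complex ^ 'n) set) \<times> (complex ^ 'n) set) set" where
  "conormal_blowup X =
     prod_topology
       (subtopology (prod_topology (top_of_set X) dual_proj_topology) (conormal_modification X))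
       proj_topology
     closure_of {((x, H), line x) |x H. (x, H) \<in> conormal_modification X \<and> x \<noteq> 0}"

definition exceptional_divisor ::
    "(complex ^ 'n) set \<Rightarrow> ((complex ^ 'n) set \<times> (complex ^ 'n) set) set" where
  "exceptional_divisor X = {(l, H). ((0, H), l) \<in> conormal_blowup X}"

definition E1_components ::
    "(complex ^ 'n) set \<Rightarrow> (complex ^ 'n) set \<Rightarrow> ((complex ^ 'n) set \<times> (complex ^ 'n) set) set set" where
  "E1_components X Y =
     {C \<in> irreducible_components (exceptional_divisor X). snd ` C \<subseteq> conormal_fibre Y}"

definition E2_components ::
    "(complex ^ 'n) set \<Rightarrow> (complex ^ 'n) set \<Rightarrow> ((complex ^ 'n) set \<times> (complex ^ 'n) set) set set" where
  "E2_components X Y = irreducible_components (exceptional_divisor X) - E1_components X Y"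

end

(* The incidence relation v \<in> H is closed in H, and since Y is linear its tangent spaces all agree with
   the one at 0; hence the fibre over 0 of the conormal modification of Y consists exactly of the
   hyperplanes containing the tangent space of Y at 0. Limits of tangent hyperplanes along x_k \<rightarrow> 0
   with x_k nonzero are the second components of points of E, because the lines through x_k
   subconverge by compactness of projective space; if instead x_k = 0 infinitely often, then 0 is
   a regular point of X and the tangent space of X at 0 already contains that of Y. So condition (a)
   says that E projects into the fibre of Y, and this can be tested on irreducible components since
   every point of E lies on one, by Zorn's lemma. *)

theory Submission
  imports Defs
begin

section \<open>The projective topologies\<close>

lemma topspace_dual_proj_topology: "topspace dual_proj_topology = hyperplanes"
  by (simp add: dual_proj_topology_def topspace_quotient_topology hyperplanes_def)

lemma continuous_map_hyperplane:
  "continuous_map (top_of_set (- {0})) dual_proj_topology hyperplane"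
  unfolding dual_proj_topology_def
  by (rule quotient_imp_continuous_map[OF quotient_map_quotient_topology])

lemma continuous_map_line: "continuous_map (top_of_set (- {0})) proj_topology line"
  unfolding proj_topology_def
  by (rule quotient_imp_continuous_map[OF quotient_map_quotient_topology])

text \<open>The preimage among coefficient vectors is where the linear form \<open>a\<close> |->
  \<open>sum a_i v_i\<close> is nonzero. This is the closedness of incidence in the
  hyperplane.\<close>

lemma openin_hyperplanes_avoiding:
  fixes v :: "complex ^ 'n"
  shows "openin dual_proj_topology {H \<in> hyperplanes. v \<notin> H}"
proof -
  have "open {a :: complex ^ 'n. (\<Sum>i\<in>UNIV. a $ i * v $ i) \<noteq> 0}"
    by (intro open_Collect_neq continuous_intros)
  then have "open (- {0} \<inter> {a :: complex ^ 'n. (\<Sum>i\<in>UNIV. a $ i * v $ i) \<noteq> 0})"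
    by (intro open_Int) auto
  moreover have "{a \<in> - {0}. hyperplane a \<in> {H \<in> hyperplanes. v \<notin> H}}
      = - {0} \<inter> {a :: complex ^ 'n. (\<Sum>i\<in>UNIV. a $ i * v $ i) \<noteq> 0}"
    by (auto simp: hyperplanes_def hyperplane_def)
  ultimately show ?thesis
    unfolding dual_proj_topology_def openin_quotient_topology
    by (auto simp: hyperplanes_def intro!: open_subset)
qed

section \<open>Fibres and openness of the quotient map to the dual projective space\<close>

lemma hyperplane_smult: "c \<noteq> 0 \<Longrightarrow> hyperplane (c *s a) = hyperplane a"
  by (simp add: hyperplane_def mult.assoc flip: sum_distrib_left)

lemma hyperplane_eq_imp_proportional:
  fixes a b :: "complex ^ 'n"
  assumes "hyperplane a = hyperplane b" "a \<noteq> 0" "b \<noteq> 0"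
  obtains c where "c \<noteq> 0" "b = c *s a"
proof -
  obtain j where j: "a $ j \<noteq> 0"
    using \<open>a \<noteq> 0\<close> by (auto simp: vec_eq_iff)
  have "b $ i * a $ j = a $ i * b $ j" for i
  proof -
    \<comment> \<open>The form with coefficients \<open>a\<close> kills this vector by construction;
      evaluating the form of \<open>b\<close> on it then makes the 2x2 minor of \<open>a\<close> and
      \<open>b\<close> in columns \<open>i\<close>, \<open>j\<close> vanish.\<close>
    define x :: "complex ^ 'n" where "x = axis i (a $ j) - axis j (a $ i)"
    have pairing: "(\<Sum>k\<in>UNIV. d $ k * x $ k) = d $ i * a $ j - d $ j * a $ i" for d :: "complex ^ 'n"
    proof -
      have "d $ k * x $ k = (if k = i then d $ k * a $ j else 0) - (if k = j then d $ k * a $ i else 0)" for k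
        by (simp add: x_def axis_def)
      then show ?thesis by (simp add: sum_subtractf)
    qed
    have "x \<in> hyperplane a"
      by (simp add: hyperplane_def pairing)
    then have "x \<in> hyperplane b"
      using assms(1) by simp
    then show ?thesis
      by (simp add: hyperplane_def pairing mult.commute)
  qed
  then have eq: "b = (b $ j / a $ j) *s a"
    using j by (simp add: vec_eq_iff field_simps)
  moreover have "b $ j / a $ j \<noteq> 0"
    using eq \<open>b \<noteq> 0\<close> by force
  ultimately show thesis
    using that by blast
qed

text \<open>The fibres of \<open>hyperplane\<close> on nonzero vectors are orbits under nonzero
  scalars, so the saturation of an open set is a union of preimages under scalings, each open.
  Images of balls thus serve as neighbourhoods of a hyperplane.\<close>

lemma openin_hyperplane_image:
  assumes "open S"
  shows "openin dual_proj_topology (hyperplane ` (S - {0}))"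
proof -
  have eq: "{a \<in> - {0}. hyperplane a \<in> hyperplane ` (S - {0})}
      = (\<Union>c\<in>- {0}. {a. c *s a \<in> S - {0}})" (is "?L = ?R")
  proof
    show "?L \<subseteq> ?R"
    proof
      fix a assume a: "a \<in> ?L"
      then obtain b where b: "b \<in> S - {0}" "hyperplane a = hyperplane b" by blast
      with a obtain c where "c \<noteq> 0" "b = c *s a"
        using hyperplane_eq_imp_proportional[of a b] by auto
      with b show "a \<in> ?R" by blast
    qed
    show "?R \<subseteq> ?L"
    proof
      fix a assume "a \<in> ?R"
      then obtain c where c: "c \<noteq> 0" "c *s a \<in> S - {0}" by blast
      then have "hyperplane a \<in> hyperplane ` (S - {0})"
        using hyperplane_smult by (metis imageI)
      with c show "a \<in> ?L" by auto
    qed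
  qed
  have "open {a. c *s a \<in> S - {0}}" for c :: complex
  proof -
    have "continuous_on UNIV (\<lambda>a :: complex ^ 'a. c *s a)"
      unfolding vector_scalar_mult_def by (intro continuous_intros)
    then have "open ((\<lambda>a. c *s a) -` (S - {0}))"
      using assms by (intro open_vimage open_delete)
    then show ?thesis by (simp add: vimage_def)
  qed
  then have "open {a \<in> - {0}. hyperplane a \<in> hyperplane ` (S - {0})}"
    unfolding eq by blast
  then show ?thesis
    unfolding dual_proj_topology_def openin_quotient_topology
    by (auto intro: open_subset)
qed

section \<open>Lines under scaling, and their sequential compactness\<close>

lemma line_smult: "c \<noteq> 0 \<Longrightarrow> line (c *s x) = line x"
  unfolding line_def vec.span_singleton
proof (intro equalityI subsetI; elim rangeE)
  fix y k assume "c \<noteq> 0" "y = k *s x"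
  then have "y = (k / c) *s (c *s x)" by simp
  then show "y \<in> range (\<lambda>k. k *s (c *s x))" by blast
qed auto

text \<open>Normalising the vectors keeps their lines; the unit sphere is compact, and
  \<open>line\<close> carries a convergent subsequence there to projective space.\<close>

lemma line_subconverges:
  fixes x :: "nat \<Rightarrow> complex ^ 'n"
  assumes "\<And>k. x k \<noteq> 0"
  obtains r l where "strict_mono r" "limitin proj_topology (\<lambda>k. line (x (r k))) l sequentially"
proof -
  have "\<forall>k. sgn (x k) \<in> sphere 0 1"
    using assms by (simp add: norm_sgn)
  then obtain u r where u: "u \<in> sphere 0 1" and r: "strict_mono r"
    and lim: "((\<lambda>k. sgn (x k)) \<circ> r) \<longlonglongrightarrow> u"
    using compact_sphere[of "0 :: complex ^ 'n" 1] unfolding compact_def by meson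
  have "limitin (top_of_set (- {0})) ((\<lambda>k. sgn (x k)) \<circ> r) u sequentially"
    using u lim assms by (auto simp: limitin_subtopology sgn_zero_iff)
  from continuous_map_limit[OF continuous_map_line this]
  have "limitin proj_topology (\<lambda>k. line (sgn (x (r k)))) (line u) sequentially"
    by (simp add: o_def)
  moreover have "line (sgn (x k)) = line (x k)" for k
  proof -
    \<comment> \<open>\<open>sgn\<close> rescales by a real number, while \<open>line\<close> is a
      complex span, so the factor is rewritten as a complex scalar.\<close>
    have "sgn (x k) = complex_of_real (inverse (norm (x k))) *s x k"
      by (simp add: sgn_div_norm vec_eq_iff) (simp add: scaleR_conv_of_real divide_inverse)
    then show ?thesis
      using assms[of k] line_smult by (metis inverse_nonzero_iff_nonzero norm_eq_zero of_real_eq_0_iff)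
  qed
  ultimately show thesis
    using that r by simp
qed

section \<open>Closures in abstract topologies\<close>

lemma closure_of_meets: "x \<in> T closure_of S \<Longrightarrow> openin T U \<Longrightarrow> x \<in> U \<Longrightarrow> \<exists>y\<in>S. y \<in> U"
  by (auto simp: in_closure_of)

lemma limitin_closure_of_sequence:
  assumes "limitin T f l sequentially" "\<And>k. f k \<in> S"
  shows "l \<in> T closure_of S"
proof -
  have "l \<in> topspace T"
    using assms(1) by (rule limitin_topspace)
  moreover have "\<exists>y. y \<in> S \<and> y \<in> U" if "l \<in> U" "openin T U" for U
    using assms that unfolding limitin_sequentially by blast
  ultimately show ?thesis
    by (auto simp: in_closure_of)
qed

section \<open>Tangent spaces and conormal fibres\<close>

lemma tangent_space_mono: "Y \<subseteq> X \<Longrightarrow> tangent_space Y p \<subseteq> tangent_space X p"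
  unfolding tangent_space_def by blast

text \<open>A function near \<open>p\<close> vanishing on \<open>Y\<close> pulls back along
  \<open>z\<close> |-> \<open>z + p\<close> to one near 0 that vanishes on \<open>Y\<close>, with
  the same differential. For a subspace \<open>Y\<close>, every \<open>p\<close> in \<open>Y\<close>
  qualifies.\<close>

lemma tangent_space_translate:
  assumes "\<And>z. z \<in> Y \<Longrightarrow> z + p \<in> Y"
  shows "tangent_space Y 0 \<subseteq> tangent_space Y p"
proof
  fix v assume v: "v \<in> tangent_space Y 0"
  have "frechet_derivative f (at p) v = 0"
    if U: "open U" "p \<in> U" and f: "holomorphic_fun_on f U" and van: "\<forall>z\<in>Y \<inter> U. f z = 0" for U f
  proof -
    define g where "g = (\<lambda>z. f (z + p))"
    define V where "V = (\<lambda>z. z + p) -` U"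
    have "open V"
      unfolding V_def using U(1) by (intro open_vimage continuous_intros)
    have der: "(g has_derivative D) (at z)" if "(f has_derivative D) (at (z + p))" for D z
    proof -
      have "((\<lambda>z. z + p) has_derivative (\<lambda>z. z)) (at z)"
        by (auto intro!: derivative_eq_intros)
      from diff_chain_at[OF this that] show ?thesis
        by (simp add: g_def o_def)
    qed
    have "holomorphic_fun_on g V"
      using f der unfolding holomorphic_fun_on_def V_def by (metis vimageE)
    moreover have "\<forall>z\<in>Y \<inter> V. g z = 0"
      using van assms by (auto simp: g_def V_def)
    moreover have "0 \<in> V"
      using U by (simp add: V_def)
    ultimately have "frechet_derivative g (at 0) v = 0"
      using v \<open>open V\<close> unfolding tangent_space_def by blast
    moreover obtain D where D: "(f has_derivative D) (at p)"
      using f U unfolding holomorphic_fun_on_def by blast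
    ultimately show ?thesis
      using der[of D 0] frechet_derivative_at by (metis add_0)
  qed
  then show "v \<in> tangent_space Y p"
    unfolding tangent_space_def by blast
qed

text \<open>If \<open>v\<close> were outside \<open>L\<close>, the open set of hyperplanes missing
  \<open>v\<close> would eventually contain every \<open>H k\<close>. Incidence for infinitely many
  \<open>k\<close> is therefore enough.\<close>

lemma limitin_hyperplane_mem:
  assumes "limitin dual_proj_topology H L sequentially" "\<exists>\<^sub>F k in sequentially. v \<in> H k"
  shows "v \<in> L"
proof (rule ccontr)
  assume "v \<notin> L"
  moreover have "L \<in> hyperplanes"
    using limitin_topspace[OF assms(1)] by (simp add: topspace_dual_proj_topology)
  ultimately have "\<forall>\<^sub>F k in sequentially. H k \<in> {H \<in> hyperplanes. v \<notin> H}"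
    using assms(1) openin_hyperplanes_avoiding unfolding limitin_def by blast
  then have "\<forall>\<^sub>F k in sequentially. v \<notin> H k"
    by (rule eventually_mono) auto
  with assms(2) show False
    by (simp add: frequently_def)
qed

section \<open>The conormal modification described by sequences\<close>

lemma conormal_modification_superset:
  "{(x, H). x \<in> regular_points X \<and> H \<in> hyperplanes \<and> tangent_space X x \<subseteq> H}
     \<subseteq> conormal_modification X"
  unfolding conormal_modification_def
  by (rule closure_of_subset) (auto simp: topspace_dual_proj_topology regular_points_def)

lemma conormal_modification_topspace:
  "conormal_modification X \<subseteq> X \<times> hyperplanes"
  using closure_of_subset_topspace[of "prod_topology (top_of_set X) dual_proj_topology"]
  by (simp add: conormal_modification_def topspace_dual_proj_topology)

text \<open>Closure is defined by open sets, whereas condition (a) speaks of sequences. Balls around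
  \<open>p\<close> and around a coefficient vector of \<open>L\<close> give countably many product
  neighbourhoods to choose from.\<close>

lemma conormal_modification_sequence:
  assumes "(p, L) \<in> conormal_modification X"
  obtains x H where "\<And>k. x k \<in> regular_points X" "\<And>k. H k \<in> hyperplanes"
    "\<And>k. tangent_space X (x k) \<subseteq> H k" "x \<longlonglongrightarrow> p" "limitin dual_proj_topology H L sequentially"
proof -
  have pL: "p \<in> X" "L \<in> hyperplanes"
    using assms conormal_modification_topspace by blast+
  then obtain a where a: "a \<noteq> 0" "L = hyperplane a"
    by (auto simp: hyperplanes_def)
  \<comment> \<open>Radii 1/(k+1): positive already at \<open>k = 0\<close>, and tending to
    0.\<close>
  define e where "e k = inverse (real (Suc k))" for k
  have e: "e k > 0" for k
    by (simp add: e_def)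
  have "\<exists>x b. x \<in> regular_points X \<and> b \<noteq> 0 \<and> tangent_space X x \<subseteq> hyperplane b
      \<and> dist p x < e k \<and> dist a b < e k" for k
  proof -
    have nbhd: "openin (prod_topology (top_of_set X) dual_proj_topology)
        ((X \<inter> ball p (e k)) \<times> hyperplane ` (ball a (e k) - {0}))"
      using openin_hyperplane_image[of "ball a (e k)"]
      by (simp add: openin_prod_Times_iff openin_open_Int)
    have mem: "(p, L) \<in> (X \<inter> ball p (e k)) \<times> hyperplane ` (ball a (e k) - {0})"
      using pL a e[of k] by auto
    obtain q where q:
        "q \<in> {(x, H). x \<in> regular_points X \<and> H \<in> hyperplanes \<and> tangent_space X x \<subseteq> H}"
        "q \<in> (X \<inter> ball p (e k)) \<times> hyperplane ` (ball a (e k) - {0})"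
      using closure_of_meets[OF assms[unfolded conormal_modification_def] nbhd mem]
      by (elim bexE)
    obtain x H where "q = (x, H)"
      by (cases q)
    with q have x: "x \<in> regular_points X" "tangent_space X x \<subseteq> H" "x \<in> ball p (e k)"
        and "H \<in> hyperplane ` (ball a (e k) - {0})"
      by simp_all
    then obtain b where "H = hyperplane b" "b \<noteq> 0" "b \<in> ball a (e k)"
      by blast
    with x show ?thesis
      by (intro exI[of _ x] exI[of _ b]) simp
  qed
  then obtain x b where xb: "\<And>k. x k \<in> regular_points X" "\<And>k. b k \<noteq> 0"
      "\<And>k. tangent_space X (x k) \<subseteq> hyperplane (b k)" "\<And>k. dist p (x k) < e k" "\<And>k. dist a (b k) < e k"
    by metis
  have e0: "e \<longlonglongrightarrow> 0"
    unfolding e_def by (rule LIMSEQ_inverse_real_of_nat)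
  have "x \<longlonglongrightarrow> p" "b \<longlonglongrightarrow> a"
    using xb(4,5) e
    by (auto intro!: metric_tendsto_imp_tendsto[OF e0] always_eventually
        simp: dist_commute less_imp_le)
  \<comment> \<open>Convergence of coefficient vectors, with nonzero limit \<open>a\<close>,
    descends to the hyperplanes because the quotient map is continuous.\<close>
  then have "limitin (top_of_set (- {0})) b a sequentially"
    using xb a by (auto simp: limitin_subtopology)
  from continuous_map_limit[OF continuous_map_hyperplane this]
  have "limitin dual_proj_topology (\<lambda>k. hyperplane (b k)) L sequentially"
    by (simp add: o_def a)
  moreover have "hyperplane (b k) \<in> hyperplanes" for k
    using xb(2) by (auto simp: hyperplanes_def)
  ultimately show thesis
    using that[of x "\<lambda>k. hyperplane (b k)"] xb(1,3) \<open>x \<longlonglongrightarrow> p\<close> by blast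
qed

text \<open>The set is a closure, hence closed, so the limit pair stays inside and convergence holds
  in the subspace topology, the first factor of the space in which the blow-up is formed.\<close>

lemma conormal_modification_limit:
  assumes "p \<in> X" "\<And>k. (x k, H k) \<in> conormal_modification X"
    "x \<longlonglongrightarrow> p" "limitin dual_proj_topology H L sequentially"
  shows "limitin (subtopology (prod_topology (top_of_set X) dual_proj_topology)
      (conormal_modification X)) (\<lambda>k. (x k, H k)) (p, L) sequentially"
proof -
  have "x k \<in> X" for k
    using assms(2) conormal_modification_topspace by blast
  then have lim: "limitin (prod_topology (top_of_set X) dual_proj_topology)
      (\<lambda>k. (x k, H k)) (p, L) sequentially"
    using assms by (simp add: limitin_pairwise o_def limitin_subtopology)
  have "(p, L) \<in> prod_topology (top_of_set X) dual_proj_topology closure_of conormal_modification X"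
    by (rule limitin_closure_of_sequence[OF lim assms(2)])
  then have "(p, L) \<in> conormal_modification X"
    by (simp add: conormal_modification_def)
  then show ?thesis
    using lim assms(2) by (simp add: limitin_subtopology)
qed

section \<open>The exceptional divisor and conormal fibres\<close>

lemma exceptional_divisor_snd:
  assumes "(l, L) \<in> exceptional_divisor X"
  shows "L \<in> conormal_fibre X"
proof -
  \<comment> \<open>The closure lies in its ambient space, whose first factor is already the
    conormal modification.\<close>
  have "((0, L), l) \<in> topspace (prod_topology
      (subtopology (prod_topology (top_of_set X) dual_proj_topology) (conormal_modification X))
      proj_topology)"
    using assms unfolding exceptional_divisor_def conormal_blowup_def mem_Collect_eq prod.case
    by (rule subsetD[OF closure_of_subset_topspace])
  then show ?thesis
    by (simp add: conormal_fibre_def)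
qed

text \<open>Along a subsequence the lines converge as well, so the points of the graph converge to a
  point of the blow-up over 0.\<close>

lemma limit_in_exceptional_divisor:
  assumes "0 \<in> X" "\<And>k. (x k, H k) \<in> conormal_modification X" "\<And>k. x k \<noteq> 0"
    "x \<longlonglongrightarrow> 0" "limitin dual_proj_topology H L sequentially"
  obtains l where "(l, L) \<in> exceptional_divisor X"
proof -
  obtain r l where r: "strict_mono r"
    and l: "limitin proj_topology (\<lambda>k. line (x (r k))) l sequentially"
    using line_subconverges[OF assms(3)] .
  have "limitin (subtopology (prod_topology (top_of_set X) dual_proj_topology)
      (conormal_modification X)) (\<lambda>k. (x (r k), H (r k))) (0, L) sequentially"
    using conormal_modification_limit[OF assms(1,2,4,5)] limitin_subsequence[OF r]
    by (fastforce simp: o_def)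
  then have "limitin (prod_topology
      (subtopology (prod_topology (top_of_set X) dual_proj_topology) (conormal_modification X))
      proj_topology) (\<lambda>k. ((x (r k), H (r k)), line (x (r k)))) ((0, L), l) sequentially"
    using l by (simp add: limitin_pairwise[of _ proj_topology] o_def)
  then have "((0, L), l) \<in> conormal_blowup X"
    unfolding conormal_blowup_def
    by (rule limitin_closure_of_sequence) (use assms in blast)
  then show thesis
    using that by (simp add: exceptional_divisor_def)
qed

text \<open>By translation each \<open>H k\<close> in an approximating sequence contains
  \<open>tangent_space Y 0\<close>, and incidence passes to the limit. Conversely, regularity of 0
  puts the pairs \<open>(0, H)\<close> into the set before closure.\<close>

lemma conormal_fibre_subspace:
  assumes "vec.subspace Y" "0 \<in> regular_points Y"
  shows "conormal_fibre Y = {H \<in> hyperplanes. tangent_space Y 0 \<subseteq> H}"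
proof (intro equalityI subsetI)
  fix L assume "L \<in> conormal_fibre Y"
  then have L: "(0, L) \<in> conormal_modification Y"
    by (simp add: conormal_fibre_def)
  obtain x H where xH: "\<And>k. x k \<in> regular_points Y" "\<And>k. tangent_space Y (x k) \<subseteq> H k"
      "limitin dual_proj_topology H L sequentially"
    using conormal_modification_sequence[OF L] by metis
  have "tangent_space Y 0 \<subseteq> H k" for k
  proof -
    have "x k \<in> Y"
      using xH(1) by (simp add: regular_points_def)
    then show ?thesis
      using tangent_space_translate[of Y "x k"] vec.subspace_add[OF assms(1)] xH(2) by blast
  qed
  then have "v \<in> L" if "v \<in> tangent_space Y 0" for v
    using limitin_hyperplane_mem[OF xH(3)] that
    by (metis eventually_frequently eventually_sequentiallyI sequentially_bot subsetD)
  then show "L \<in> {H \<in> hyperplanes. tangent_space Y 0 \<subseteq> H}"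
    using L conormal_modification_topspace by auto
next
  fix L assume "L \<in> {H \<in> hyperplanes. tangent_space Y 0 \<subseteq> H}"
  then show "L \<in> conormal_fibre Y"
    using assms(2) conormal_modification_superset[of Y] by (auto simp: conormal_fibre_def)
qed

section \<open>Irreducible components\<close>

text \<open>Supplies the upper bounds of chains for Zorn's lemma.\<close>

lemma biproj_irreducible_Union_chain:
  assumes "subset.chain {C. biproj_irreducible C} \<C>" and "\<C> \<noteq> {}"
  shows "biproj_irreducible (\<Union>\<C>)"
  unfolding biproj_irreducible_def
proof (intro conjI allI impI)
  have member: "biproj_irreducible C" if "C \<in> \<C>" for C
    using assms(1) that by (auto simp: subset_chain_def)
  obtain C where "C \<in> \<C>"
    using \<open>\<C> \<noteq> {}\<close> by blast
  with member[OF this] show "\<Union>\<C> \<noteq> {}"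
    by (auto simp: biproj_irreducible_def)
  fix A B
  assume AB: "biproj_analytic A \<and> biproj_analytic B \<and> \<Union>\<C> \<subseteq> A \<union> B"
  have irr: "C \<subseteq> A \<or> C \<subseteq> B" if "C \<in> \<C>" for C
  proof -
    have "C \<subseteq> A \<union> B"
      using that AB by auto
    with AB member[OF that] show ?thesis
      by (simp add: biproj_irreducible_def)
  qed
  show "\<Union>\<C> \<subseteq> A \<or> \<Union>\<C> \<subseteq> B"
  proof (rule disjCI)
    assume "\<not> \<Union>\<C> \<subseteq> B"
    \<comment> \<open>Since \<open>D\<close> is not inside \<open>B\<close>, it is inside
      \<open>A\<close>. Smaller members lie in \<open>D\<close>, hence in \<open>A\<close>; larger
      ones are not inside \<open>B\<close> either, hence are inside \<open>A\<close>.\<close>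
    then obtain D where D: "D \<in> \<C>" "\<not> D \<subseteq> B"
      by (auto simp: Sup_le_iff)
    show "\<Union>\<C> \<subseteq> A"
    proof (rule Union_least)
      fix C assume C: "C \<in> \<C>"
      then have "C \<subseteq> D \<or> D \<subseteq> C"
        using assms(1) D(1) by (simp add: subset_chain_def)
      then show "C \<subseteq> A"
        using irr[OF C] irr[OF D(1)] D(2) by (metis order_trans)
    qed
  qed
qed

lemma mem_irreducible_component:
  assumes "p \<in> S"
  obtains C where "C \<in> irreducible_components S" "p \<in> C"
proof -
  let ?\<A> = "{C. C \<subseteq> S \<and> biproj_irreducible C \<and> p \<in> C}"
  have "{p} \<in> ?\<A>"
    using assms by (simp add: biproj_irreducible_def)
  then have "?\<A> \<noteq> {}" by blast
  then obtain M where M: "M \<in> ?\<A>" "\<forall>C\<in>?\<A>. M \<subseteq> C \<longrightarrow> C = M"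
  proof (rule subset_Zorn_nonempty[THEN bexE])
    fix \<C> assume \<C>: "\<C> \<noteq> {}" "subset.chain ?\<A> \<C>"
    then have "subset.chain {C. biproj_irreducible C} \<C>"
      by (auto simp: subset_chain_def)
    from biproj_irreducible_Union_chain[OF this \<C>(1)] show "\<Union>\<C> \<in> ?\<A>"
      using \<C> by (auto simp: subset_chain_def)
  qed
  \<comment> \<open>Any irreducible set containing \<open>M\<close> also contains \<open>p\<close>,
    so maximality among the sets through \<open>p\<close> is maximality outright.\<close>
  then have "M \<in> irreducible_components S"
    unfolding irreducible_components_def by blast
  with M(1) that show thesis by blast
qed

text \<open>The components lie in the exceptional divisor and cover it, so the inclusion holds
  exactly when it holds on each of them.\<close>

lemma E2_components_empty_iff:
  "E2_components X Y = {} \<longleftrightarrow> snd ` exceptional_divisor X \<subseteq> conormal_fibre Y"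
proof
  assume E2: "E2_components X Y = {}"
  show "snd ` exceptional_divisor X \<subseteq> conormal_fibre Y"
  proof (rule image_subsetI)
    fix p assume "p \<in> exceptional_divisor X"
    then obtain C where "C \<in> irreducible_components (exceptional_divisor X)" "p \<in> C"
      by (rule mem_irreducible_component)
    with E2 show "snd p \<in> conormal_fibre Y"
      unfolding E2_components_def E1_components_def by blast
  qed
next
  assume "snd ` exceptional_divisor X \<subseteq> conormal_fibre Y"
  then show "E2_components X Y = {}"
    unfolding E2_components_def E1_components_def irreducible_components_def by blast
qed

theorem proposition3p1:
  fixes X Y :: "(complex ^ 'n) set"
  assumes "analytic_subset_of UNIV X" and "analytic_subset_of UNIV Y"
    and "Y \<subseteq> X" and "0 \<in> Y"
    and "singular_set Y = {}" and "vec.subspace Y"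
    and "singular_set X \<subseteq> Y"
  shows "whitney_a X Y 0 \<longleftrightarrow> E2_components X Y = {}"
proof -
  have "0 \<in> regular_points Y"
    using assms(4,5) by (auto simp: singular_set_def)
  then have fibre: "conormal_fibre Y = {H \<in> hyperplanes. tangent_space Y 0 \<subseteq> H}"
    using assms(6) by (intro conormal_fibre_subspace)
  have "whitney_a X Y 0 \<longleftrightarrow> snd ` exceptional_divisor X \<subseteq> conormal_fibre Y"
  proof
    assume wa: "whitney_a X Y 0"
    show "snd ` exceptional_divisor X \<subseteq> conormal_fibre Y"
    proof clarsimp
      fix l L assume "(l, L) \<in> exceptional_divisor X"
      then have L: "(0, L) \<in> conormal_modification X"
        using exceptional_divisor_snd by (auto simp: conormal_fibre_def)
      obtain x H where "\<And>k. x k \<in> regular_points X" "\<And>k. H k \<in> hyperplanes"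
        "\<And>k. tangent_space X (x k) \<subseteq> H k" "x \<longlonglongrightarrow> 0"
        "limitin dual_proj_topology H L sequentially"
        using conormal_modification_sequence[OF L] by metis
      then have "tangent_space Y 0 \<subseteq> L"
        using wa unfolding whitney_a_def by blast
      then show "L \<in> conormal_fibre Y"
        using L conormal_modification_topspace by (auto simp: fibre)
    qed
  next
    assume E: "snd ` exceptional_divisor X \<subseteq> conormal_fibre Y"
    show "whitney_a X Y 0"
      unfolding whitney_a_def
    proof (intro allI impI subsetI; elim conjE)
      fix x H L v
      assume xH: "\<forall>k. x k \<in> regular_points X \<and> H k \<in> hyperplanes \<and> tangent_space X (x k) \<subseteq> H k"
        and x: "x \<longlonglongrightarrow> 0" and H: "limitin dual_proj_topology H L sequentially"
        and v: "v \<in> tangent_space Y 0"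
      show "v \<in> L"
      proof (cases "\<exists>\<^sub>F k in sequentially. x k = 0")
        case True
        then have "\<exists>\<^sub>F k in sequentially. v \<in> H k"
          by (rule frequently_elim1) (use xH v tangent_space_mono[OF assms(3)] in fastforce)
        with H show ?thesis by (rule limitin_hyperplane_mem)
      next
        case False
        then obtain N where N: "\<And>k. k \<ge> N \<Longrightarrow> x k \<noteq> 0"
          by (auto simp: frequently_def eventually_sequentially)
        \<comment> \<open>The graph in the blow-up is defined only off 0; shifting by
          \<open>N\<close> makes every base point nonzero and keeps the limits.\<close>
        have "(x (k + N), H (k + N)) \<in> conormal_modification X" for k
          using xH conormal_modification_superset by blast
        moreover have "(\<lambda>k. x (k + N)) \<longlonglongrightarrow> 0"
          using x by (rule LIMSEQ_ignore_initial_segment)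
        moreover have "limitin dual_proj_topology (\<lambda>k. H (k + N)) L sequentially"
          using H by (rule limitin_sequentially_offset)
        moreover have "0 \<in> X"
          using assms(3,4) by blast
        moreover have "x (k + N) \<noteq> 0" for k
          using N by simp
        ultimately obtain l where "(l, L) \<in> exceptional_divisor X"
          using limit_in_exceptional_divisor[of X "\<lambda>k. x (k + N)" "\<lambda>k. H (k + N)" L] by metis
        then have "L \<in> conormal_fibre Y"
          using E by force
        with v show ?thesis by (auto simp: fibre)
      qed
    qed
  qed
  then show ?thesis
    by (simp add: E2_components_empty_iff)
qed

end
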